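(* Let $\alpha\in\mathbb{R}\setminus\{0\}$, $\beta>0$ and let $\mathbf{X}\in\mathbb{T}_{\alpha\beta}^{p\times p}$ be written as $\mathbf{X}=\mathbf{X}_s\mathrm{w}_1+\mathbf{X}_d\mathrm{w}_2$ with $\mathbf{X}_s,\mathbf{X}_d\in\mathbb{C}_\alpha^{p\times p}$. Let $(\mathbf{P}_s,\mathbf{L}_s,\mathbf{U}_s)$ and $(\mathbf{P}_d,\mathbf{L}_d,\mathbf{U}_d)$ be the matrices of the LU factorizations with partial pivoting of the $(\alpha)$-complex matrices $\mathbf{X}_s$ and $\mathbf{X}_d$, respectively (in the sense given in the context). Then the matrices $(\mathbf{P},\mathbf{L},\mathbf{U})$ of the LU factorization with partial pivoting of $\mathbf{X}$ are $$\mathbf{P}=\frac{\mathbf{P}_s+\mathbf{P}_d}{2}+\frac{\mathbf{P}_s-\mathbf{P}_d}{2\sqrt\beta}\mathrm{j},\quad \mathbf{L}=\frac{\mathbf{L}_s+\mathbf{L}_d}{2}+\frac{\mathbf{L}_s-\mathbf{L}_d}{2\sqrt\beta}\mathrm{j},\quad \mathbf{U}=\frac{\mathbf{U}_s+\mathbf{U}_d}{2}+\frac{\mathbf{U}_s-\mathbf{U}_d}{2\sqrt\beta}\mathrm{j};$$ that is, $\mathbf{P}\mathbf{X}=\mathbf{L}\mathbf{U}$ with $\mathbf{L}$ lower triangular and $\mathbf{U}$ upper triangular.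
   Context: $\mathbb{T}_{\alpha\beta}$ (the $(\alpha\beta)$-tessarines) is the commutative, associative real algebra with basis $1,\mathrm{i},\mathrm{j},\mathrm{k}$ and multiplication $\mathrm{i}^2=\alpha$, $\mathrm{j}^2=\beta$, $\mathrm{k}^2=\alpha\beta$, $\mathrm{i}\mathrm{j}=\mathrm{k}$, $\mathrm{i}\mathrm{k}=\alpha\mathrm{j}$, $\mathrm{j}\mathrm{k}=\beta\mathrm{i}$. $\mathbb{C}_\alpha=\{a+b\mathrm{i}: a,b\in\mathbb{R}\}$. Put $\mathrm{w}_1=\frac{\sqrt\beta+\mathrm{j}}{2\sqrt\beta}$, $\mathrm{w}_2=\frac{\sqrt\beta-\mathrm{j}}{2\sqrt\beta}$. A matrix $\mathbf{X}=\mathbf{A}+\mathbf{B}\mathrm{i}+\mathbf{C}\mathrm{j}+\mathbf{D}\mathrm{k}$ with real $\mathbf{A},\mathbf{B},\mathbf{C},\mathbf{D}$ is written $\mathbf{X}=\mathbf{X}_s\mathrm{w}_1+\mathbf{X}_d\mathrm{w}_2$, where $\mathbf{X}_s=\mathbf{X}_a+\sqrt\beta\,\mathbf{X}_b$, $\mathbf{X}_d=\mathbf{X}_a-\sqrt\beta\,\mathbf{X}_b$, $\mathbf{X}_a=\mathbf{A}+\mathbf{B}\mathrm{i}$, $\mathbf{X}_b=\mathbf{C}+\mathbf{D}\mathrm{i}$. LU factorization with partial pivoting of a real or complex square matrix $\mathbf{Z}$: matrices $(\mathbf{P},\mathbf{L},\mathbf{U})$ with $\mathbf{P}\mathbf{Z}=\mathbf{L}\mathbf{U}$,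 $\mathbf{P}$ a permutation matrix, $\mathbf{L}$ lower triangular, $\mathbf{U}$ upper triangular. LU factorization with partial pivoting of an $(\alpha)$-complex matrix $\mathbf{Z}=\mathbf{A}+\mathbf{B}\mathrm{i}\in\mathbb{C}_\alpha^{p\times p}$ ($\mathbf{A},\mathbf{B}$ real): (i) if $\alpha<0$, take an LU factorization with partial pivoting $(\dot{\mathbf{P}},\mathbf{L}_1+\mathbf{L}_2\epsilon,\mathbf{U}_1+\mathbf{U}_2\epsilon)$ of the complex matrix $\mathbf{A}+\sqrt{|\alpha|}\,\mathbf{B}\epsilon$ ($\epsilon^2=-1$, $\mathbf{L}_1,\mathbf{L}_2,\mathbf{U}_1,\mathbf{U}_2$ real), and use $\big(\dot{\mathbf{P}},\ \mathbf{L}_1+\tfrac{1}{\sqrt{|\alpha|}}\mathbf{L}_2\mathrm{i},\ \mathbf{U}_1+\tfrac{1}{\sqrt{|\alpha|}}\mathbf{U}_2\mathrm{i}\big)$; (ii) if $\alpha>0$, take LU factorizations with partial pivoting $(\mathbf{P}_+,\mathbf{L}_+,\mathbf{U}_+)$ and $(\mathbf{P}_-,\mathbf{L}_-,\mathbf{U}_-)$ of the real matrices $\mathbf{A}+\sqrt\alpha\,\mathbf{B}$ and $\mathbf{A}-\sqrt\alpha\,\mathbf{B}$, and use the three matrices $\frac{\mathbf{M}_++\mathbf{M}_-}{2}+\frac{\mathbf{M}_+-\mathbf{M}_-}{2\sqrt\alpha}\mathrm{i}$ for $\mathbf{M}=\mathbf{P},\mathbf{L},\mathbf{U}$. For matrices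 over $\mathbb{T}_{\alpha\beta}$ an LU factorization with partial pivoting means $\mathbf{P}\mathbf{X}=\mathbf{L}\mathbf{U}$ with $\mathbf{L}$ lower and $\mathbf{U}$ upper triangular; $\mathbf{P}$ is then not required to be a binary permutation matrix. *)

theory Defs
  imports Complex_Main "HOL-Combinatorics.Permutations" "Jordan_Normal_Form.Matrix"
begin

text \<open>The additive structure of the tessarines does not depend on the parameters
  \<open>\<alpha>\<close>, \<open>\<beta>\<close>; only the multiplication does. So there is a single carrier type,
  a real vector space, and the product takes the parameters as arguments.\<close>

datatype tess = Tess (t_one: real) (t_i: real) (t_j: real) (t_k: real)

instantiation tess :: real_vector
begin

definition "0 = Tess 0 0 0 0"
definition "x + y = Tess (t_one x + t_one y) (t_i x + t_i y) (t_j x + t_j y) (t_k x + t_k y)"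
definition "- x = Tess (- t_one x) (- t_i x) (- t_j x) (- t_k x)"
definition "x - y = Tess (t_one x - t_one y) (t_i x - t_i y) (t_j x - t_j y) (t_k x - t_k y)"
definition "r *\<^sub>R x = Tess (r * t_one x) (r * t_i x) (r * t_j x) (r * t_k x)"

instance
  by standard
    (auto simp: zero_tess_def plus_tess_def uminus_tess_def minus_tess_def scaleR_tess_def
      algebra_simps)

end

lemma tess_sel_simps [simp]:
  "t_one 0 = 0" "t_i 0 = 0" "t_j 0 = 0" "t_k 0 = 0"
  "t_one (x + y) = t_one x + t_one y" "t_i (x + y) = t_i x + t_i y"
  "t_j (x + y) = t_j x + t_j y" "t_k (x + y) = t_k x + t_k y"
  "t_one (x - y) = t_one x - t_one y" "t_i (x - y) = t_i x - t_i y"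
  "t_j (x - y) = t_j x - t_j y" "t_k (x - y) = t_k x - t_k y"
  "t_one (- x) = - t_one x" "t_i (- x) = - t_i x"
  "t_j (- x) = - t_j x" "t_k (- x) = - t_k x"
  "t_one (r *\<^sub>R x) = r * t_one x" "t_i (r *\<^sub>R x) = r * t_i x"
  "t_j (r *\<^sub>R x) = r * t_j x" "t_k (r *\<^sub>R x) = r * t_k x"
  by (simp_all add: zero_tess_def plus_tess_def uminus_tess_def minus_tess_def scaleR_tess_def)

definition unit_one :: tess where "unit_one = Tess 1 0 0 0"
definition unit_i :: tess where "unit_i = Tess 0 1 0 0"
definition unit_j :: tess where "unit_j = Tess 0 0 1 0"
definition unit_k :: tess where "unit_k = Tess 0 0 0 1"

lemmas tess_unit_defs = unit_one_def unit_i_def unit_j_def unit_k_def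

definition tess_mult :: "real \<Rightarrow> real \<Rightarrow> tess \<Rightarrow> tess \<Rightarrow> tess" where
  "tess_mult \<alpha> \<beta> x y = Tess
     (t_one x * t_one y + \<alpha> * t_i x * t_i y + \<beta> * t_j x * t_j y + \<alpha> * \<beta> * t_k x * t_k y)
     (t_one x * t_i y + t_i x * t_one y + \<beta> * (t_j x * t_k y + t_k x * t_j y))
     (t_one x * t_j y + t_j x * t_one y + \<alpha> * (t_i x * t_k y + t_k x * t_i y))
     (t_one x * t_k y + t_k x * t_one y + t_i x * t_j y + t_j x * t_i y)"

text \<open>The product is the commutative bilinear one determined by the multiplication
  table of the basis, and it is associative.\<close>

lemma tess_mult_table:
  "tess_mult \<alpha> \<beta> unit_one x = x"
  "tess_mult \<alpha> \<beta> unit_i unit_i = \<alpha> *\<^sub>R unit_one"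
  "tess_mult \<alpha> \<beta> unit_j unit_j = \<beta> *\<^sub>R unit_one"
  "tess_mult \<alpha> \<beta> unit_k unit_k = (\<alpha> * \<beta>) *\<^sub>R unit_one"
  "tess_mult \<alpha> \<beta> unit_i unit_j = unit_k"
  "tess_mult \<alpha> \<beta> unit_i unit_k = \<alpha> *\<^sub>R unit_j"
  "tess_mult \<alpha> \<beta> unit_j unit_k = \<beta> *\<^sub>R unit_i"
  by (simp_all add: tess_mult_def tess_unit_defs scaleR_tess_def)

lemma tess_mult_commute: "tess_mult \<alpha> \<beta> x y = tess_mult \<alpha> \<beta> y x"
  by (simp add: tess_mult_def algebra_simps)

lemma tess_mult_assoc:
  "tess_mult \<alpha> \<beta> (tess_mult \<alpha> \<beta> x y) z = tess_mult \<alpha> \<beta> x (tess_mult \<alpha> \<beta> y z)"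
  by (simp add: tess_mult_def algebra_simps)

lemma tess_mult_add_left:
  "tess_mult \<alpha> \<beta> (x + y) z = tess_mult \<alpha> \<beta> x z + tess_mult \<alpha> \<beta> y z"
  by (rule tess.expand) (simp add: tess_mult_def algebra_simps)

lemma tess_mult_scaleR_left:
  "tess_mult \<alpha> \<beta> (r *\<^sub>R x) z = r *\<^sub>R tess_mult \<alpha> \<beta> x z"
  by (rule tess.expand) (simp add: tess_mult_def algebra_simps)

definition alpha_complex :: "tess set" where
  "alpha_complex = range (\<lambda>(a, b). a *\<^sub>R unit_one + b *\<^sub>R unit_i)"

definition w1 :: "real \<Rightarrow> tess" where
  "w1 \<beta> = (1 / (2 * sqrt \<beta>)) *\<^sub>R (sqrt \<beta> *\<^sub>R unit_one + unit_j)"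

definition w2 :: "real \<Rightarrow> tess" where
  "w2 \<beta> = (1 / (2 * sqrt \<beta>)) *\<^sub>R (sqrt \<beta> *\<^sub>R unit_one - unit_j)"

text \<open>The library product and scalar product of matrices use the class operation \<open>*\<close>,
  which \<open>tess\<close> cannot have; addition and subtraction are those of the library.\<close>

definition tess_mat_mult :: "real \<Rightarrow> real \<Rightarrow> tess mat \<Rightarrow> tess mat \<Rightarrow> tess mat" where
  "tess_mat_mult \<alpha> \<beta> M N = mat (dim_row M) (dim_col N)
     (\<lambda>(i, j). \<Sum>k<dim_col M. tess_mult \<alpha> \<beta> (M $$ (i, k)) (N $$ (k, j)))"

definition tess_mat_smult :: "real \<Rightarrow> real \<Rightarrow> tess mat \<Rightarrow> tess \<Rightarrow> tess mat" where
  "tess_mat_smult \<alpha> \<beta> M t = map_mat (\<lambda>x. tess_mult \<alpha> \<beta> x t) M"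

definition lower_triangular :: "'a::zero mat \<Rightarrow> bool" where
  "lower_triangular M \<longleftrightarrow> (\<forall>i<dim_row M. \<forall>j<dim_col M. i < j \<longrightarrow> M $$ (i, j) = 0)"

definition permutation_matrix :: "nat \<Rightarrow> 'a::{zero,one} mat \<Rightarrow> bool" where
  "permutation_matrix p M \<longleftrightarrow>
     (\<exists>\<sigma>. \<sigma> permutes {..<p} \<and> M = mat p p (\<lambda>(i, j). if j = \<sigma> i then 1 else 0))"

text \<open>Used below for real and for complex matrices only.\<close>

definition is_LUPP :: "nat \<Rightarrow> 'a::field mat \<Rightarrow> 'a mat \<Rightarrow> 'a mat \<Rightarrow> 'a mat \<Rightarrow> bool" where
  "is_LUPP p Z P L U \<longleftrightarrow>
     Z \<in> carrier_mat p p \<and> P \<in> carrier_mat p p \<and> L \<in> carrier_mat p p \<and> U \<in> carrier_mat p p \<and>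
     P * Z = L * U \<and> permutation_matrix p P \<and> lower_triangular L \<and> upper_triangular U"

text \<open>The tessarine matrix \<open>A + B i\<close> for real \<open>A\<close>, \<open>B\<close>.\<close>

definition cmat :: "real mat \<Rightarrow> real mat \<Rightarrow> tess mat" where
  "cmat A B = map_mat (\<lambda>a. a *\<^sub>R unit_one) A + map_mat (\<lambda>b. b *\<^sub>R unit_i) B"

text \<open>From \<open>M\<^sub>1 + M\<^sub>2 \<epsilon>\<close> over the ordinary complex numbers to \<open>M\<^sub>1 + (1 / sqrt \<bar>\<alpha>\<bar>) M\<^sub>2 i\<close>.
  A real matrix, in particular a permutation matrix, is mapped to itself.\<close>

definition from_complex_mat :: "real \<Rightarrow> complex mat \<Rightarrow> tess mat" where
  "from_complex_mat \<alpha> M = cmat (map_mat Re M) ((1 / sqrt \<bar>\<alpha>\<bar>) \<cdot>\<^sub>m map_mat Im M)"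

definition from_real_mats :: "real \<Rightarrow> real mat \<Rightarrow> real mat \<Rightarrow> tess mat" where
  "from_real_mats \<alpha> M_pos M_neg =
     cmat ((1 / 2) \<cdot>\<^sub>m (M_pos + M_neg)) ((1 / (2 * sqrt \<alpha>)) \<cdot>\<^sub>m (M_pos - M_neg))"

text \<open>Factorizations are not unique, so this is a relation: \<open>(P, L, U)\<close> is a triple obtained
  by the construction from some factorization(s) of the associated complex or real matrices.\<close>

definition is_alpha_LUPP ::
    "nat \<Rightarrow> real \<Rightarrow> tess mat \<Rightarrow> tess mat \<Rightarrow> tess mat \<Rightarrow> tess mat \<Rightarrow> bool" where
  "is_alpha_LUPP p \<alpha> Z P L U \<longleftrightarrow>
     (let A = map_mat t_one Z; B = map_mat t_i Z in
       Z \<in> carrier_mat p p \<and> elements_mat Z \<subseteq> alpha_complex \<and>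
       ((\<alpha> < 0 \<and>
         (\<exists>P' L' U'.
            is_LUPP p
              (map_mat complex_of_real A +
               (complex_of_real (sqrt \<bar>\<alpha>\<bar>) * \<i>) \<cdot>\<^sub>m map_mat complex_of_real B) P' L' U' \<and>
            P = from_complex_mat \<alpha> P' \<and>
            L = from_complex_mat \<alpha> L' \<and>
            U = from_complex_mat \<alpha> U')) \<or>
        (\<alpha> > 0 \<and>
         (\<exists>P_pos L_pos U_pos P_neg L_neg U_neg.
            is_LUPP p (A + sqrt \<alpha> \<cdot>\<^sub>m B) P_pos L_pos U_pos \<and>
            is_LUPP p (A - sqrt \<alpha> \<cdot>\<^sub>m B) P_neg L_neg U_neg \<and>
            P = from_real_mats \<alpha> P_pos P_neg \<and>
            L = from_real_mats \<alpha> L_pos L_neg \<and>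
            U = from_real_mats \<alpha> U_pos U_neg))))"

text \<open>\<open>P\<close> need not be a permutation matrix here.\<close>

definition is_tess_LUPP ::
    "nat \<Rightarrow> real \<Rightarrow> real \<Rightarrow> tess mat \<Rightarrow> tess mat \<Rightarrow> tess mat \<Rightarrow> tess mat \<Rightarrow> bool" where
  "is_tess_LUPP p \<alpha> \<beta> X P L U \<longleftrightarrow>
     X \<in> carrier_mat p p \<and> P \<in> carrier_mat p p \<and> L \<in> carrier_mat p p \<and> U \<in> carrier_mat p p \<and>
     tess_mat_mult \<alpha> \<beta> P X = tess_mat_mult \<alpha> \<beta> L U \<and> lower_triangular L \<and> upper_triangular U"

text \<open>\<open>(M\<^sub>s + M\<^sub>d) / 2 + ((M\<^sub>s - M\<^sub>d) / (2 sqrt \<beta>)) j\<close>\<close>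

definition combine_sd :: "real \<Rightarrow> real \<Rightarrow> tess mat \<Rightarrow> tess mat \<Rightarrow> tess mat" where
  "combine_sd \<alpha> \<beta> M\<^sub>s M\<^sub>d =
     map_mat (\<lambda>x. (1 / 2) *\<^sub>R x) (M\<^sub>s + M\<^sub>d) +
     tess_mat_smult \<alpha> \<beta> (map_mat (\<lambda>x. (1 / (2 * sqrt \<beta>)) *\<^sub>R x) (M\<^sub>s - M\<^sub>d)) unit_j"

text \<open>The decomposition \<open>X = X\<^sub>s w\<^sub>1 + X\<^sub>d w\<^sub>2\<close> with \<open>X\<^sub>s\<close>, \<open>X\<^sub>d\<close> over the \<open>\<alpha>\<close>-complex numbers
  exists and is unique: for \<open>X = A + B i + C j + D k\<close> it is given by
  \<open>X\<^sub>s = X\<^sub>a + sqrt \<beta> X\<^sub>b\<close> and \<open>X\<^sub>d = X\<^sub>a - sqrt \<beta> X\<^sub>b\<close>, where \<open>X\<^sub>a = A + B i\<close>, \<open>X\<^sub>b = C + D i\<close>.\<close>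

definition part_a :: "tess mat \<Rightarrow> tess mat" where
  "part_a X = cmat (map_mat t_one X) (map_mat t_i X)"

definition part_b :: "tess mat \<Rightarrow> tess mat" where
  "part_b X = cmat (map_mat t_j X) (map_mat t_k X)"

lemma idempotent_decomposition:
  assumes "\<beta> > 0" and X: "X \<in> carrier_mat p p"
    and S: "X\<^sub>s \<in> carrier_mat p p" and D: "X\<^sub>d \<in> carrier_mat p p"
  shows "(elements_mat X\<^sub>s \<subseteq> alpha_complex \<and> elements_mat X\<^sub>d \<subseteq> alpha_complex \<and>
          X = tess_mat_smult \<alpha> \<beta> X\<^sub>s (w1 \<beta>) + tess_mat_smult \<alpha> \<beta> X\<^sub>d (w2 \<beta>)) \<longleftrightarrow>
         (X\<^sub>s = part_a X + map_mat (\<lambda>x. sqrt \<beta> *\<^sub>R x) (part_b X) \<and>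
          X\<^sub>d = part_a X - map_mat (\<lambda>x. sqrt \<beta> *\<^sub>R x) (part_b X))"
    (is "?L \<longleftrightarrow> ?R")
proof -
  define s where "s = sqrt \<beta>"
  have s: "s > 0" "\<beta> = s * s" using assms(1) by (auto simp: s_def)
  have ac: "elements_mat M \<subseteq> alpha_complex \<longleftrightarrow>
      (\<forall>i<p. \<forall>j<p. t_j (M $$ (i, j)) = 0 \<and> t_k (M $$ (i, j)) = 0)"
    if M: "M \<in> carrier_mat p p" for M
  proof -
    have 1: "x \<in> alpha_complex \<longleftrightarrow> t_j x = 0 \<and> t_k x = 0" for x
    proof
      assume "x \<in> alpha_complex"
      then show "t_j x = 0 \<and> t_k x = 0" by (auto simp: alpha_complex_def tess_unit_defs)
    next
      assume "t_j x = 0 \<and> t_k x = 0"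
      then have "x = (\<lambda>(a, b). a *\<^sub>R unit_one + b *\<^sub>R unit_i) (t_one x, t_i x)"
        by (intro tess.expand) (simp add: tess_unit_defs)
      then show "x \<in> alpha_complex" unfolding alpha_complex_def by blast
    qed
    have "elements_mat M = {M $$ (i, j) | i j. i < p \<and> j < p}"
      using M by (auto simp: elements_mat_def; blast)
    then have "elements_mat M \<subseteq> alpha_complex \<longleftrightarrow> (\<forall>i<p. \<forall>j<p. M $$ (i, j) \<in> alpha_complex)"
      by (simp only:) auto
    then show ?thesis by (simp add: 1)
  qed
  have eqs: "M = N \<longleftrightarrow> (\<forall>i<p. \<forall>j<p. M $$ (i, j) = N $$ (i, j))"
    if "M \<in> carrier_mat p p" "N \<in> carrier_mat p p" for M N :: "tess mat"
    using that by (auto intro!: eq_matI)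
  have pt: "(t_j u = 0 \<and> t_k u = 0 \<and> t_j v = 0 \<and> t_k v = 0 \<and>
        x = tess_mult \<alpha> \<beta> u (w1 \<beta>) + tess_mult \<alpha> \<beta> v (w2 \<beta>)) \<longleftrightarrow>
      (u = (t_one x *\<^sub>R unit_one + t_i x *\<^sub>R unit_i) + s *\<^sub>R (t_j x *\<^sub>R unit_one + t_k x *\<^sub>R unit_i) \<and>
       v = (t_one x *\<^sub>R unit_one + t_i x *\<^sub>R unit_i) - s *\<^sub>R (t_j x *\<^sub>R unit_one + t_k x *\<^sub>R unit_i))"
    for u v x
  proof -
    have h: "tess_mult \<alpha> \<beta> (Tess a b 0 0) (w1 \<beta>) = Tess (a / 2) (b / 2) (a / (2 * s)) (b / (2 * s))"
      "tess_mult \<alpha> \<beta> (Tess a b 0 0) (w2 \<beta>) = Tess (a / 2) (b / 2) (- a / (2 * s)) (- b / (2 * s))"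
      for a b
      unfolding w1_def w2_def s_def[symmetric]
      using s(1) by (simp_all add: tess_mult_def tess_unit_defs)
    have r: "(a = m / 2 + n / 2 \<and> c = m / (2 * s) + - n / (2 * s)) \<longleftrightarrow>
        (m = a + s * c \<and> n = a - s * c)" for a c m n :: real
    proof -
      have "(c = m / (2 * s) + - n / (2 * s)) \<longleftrightarrow> 2 * (s * c) = m - n"
        using s(1) by (auto simp: field_simps)
      moreover have "(a = m / 2 + n / 2 \<and> 2 * (s * c) = m - n) \<longleftrightarrow> (m = a + s * c \<and> n = a - s * c)"
        by (rule iffI; elim conjE; rule conjI; linarith)
      ultimately show ?thesis by (simp only:)
    qed
    show ?thesis
    proof (cases "t_j u = 0 \<and> t_k u = 0 \<and> t_j v = 0 \<and> t_k v = 0")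
      case True
      then obtain m m' n n' where uv: "u = Tess m m' 0 0" "v = Tess n n' 0 0"
        by (cases u; cases v) simp
      obtain a b c d where x: "x = Tess a b c d" by (cases x)
      have "?thesis \<longleftrightarrow>
          ((a = m / 2 + n / 2 \<and> c = m / (2 * s) + - n / (2 * s)) \<and>
           (b = m' / 2 + n' / 2 \<and> d = m' / (2 * s) + - n' / (2 * s)) \<longleftrightarrow>
           (m = a + s * c \<and> n = a - s * c) \<and> (m' = b + s * d \<and> n' = b - s * d))"
        unfolding uv x h
        by (simp add: tess_unit_defs plus_tess_def minus_tess_def scaleR_tess_def conj_ac
            del: minus_divide_left)
      then show ?thesis unfolding r by blast
    next
      case False
      then show ?thesis by (auto simp: tess_unit_defs)
    qed
  qed
  have cm: "part_a X \<in> carrier_mat p p" "part_b X \<in> carrier_mat p p"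
    using X by (auto simp: part_a_def part_b_def cmat_def)
  have "?L \<longleftrightarrow> (\<forall>i<p. \<forall>j<p. (t_j (X\<^sub>s $$ (i, j)) = 0 \<and> t_k (X\<^sub>s $$ (i, j)) = 0 \<and>
      t_j (X\<^sub>d $$ (i, j)) = 0 \<and> t_k (X\<^sub>d $$ (i, j)) = 0 \<and>
      X $$ (i, j) = tess_mult \<alpha> \<beta> (X\<^sub>s $$ (i, j)) (w1 \<beta>) + tess_mult \<alpha> \<beta> (X\<^sub>d $$ (i, j)) (w2 \<beta>)))"
    using X S D by (subst eqs) (auto simp: ac tess_mat_smult_def)
  also have "\<dots> \<longleftrightarrow> ?R"
    unfolding pt using X S D cm
    by (subst (1 2) eqs) (auto simp: part_a_def part_b_def cmat_def s_def)
  finally show ?thesis .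
qed

end

theory Submission
  imports Defs
begin

text \<open>The elements \<open>w\<^sub>1\<close>, \<open>w\<^sub>2\<close> are orthogonal idempotents, so
  \<open>(x, y) \<mapsto> x w\<^sub>1 + y w\<^sub>2\<close> is multiplicative, and \<open>combine_sd\<close> is this map applied entrywise.
  Likewise, for \<open>\<alpha> < 0\<close> the \<open>\<alpha>\<close>-complex numbers are a copy of the complex numbers, and for
  \<open>\<alpha> > 0\<close> a copy of the product of two copies of the reals. Each of the three maps preserves
  matrix products and zero entries, hence transports factorizations.\<close>

text \<open>Separate argument types let one notion serve pairs of complex, real and tessarine
  matrices. The dimensions are read off \<open>M\<close>.\<close>

definition zip_mat :: "('a \<Rightarrow> 'b \<Rightarrow> 'c) \<Rightarrow> 'a mat \<Rightarrow> 'b mat \<Rightarrow> 'c mat" where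
  "zip_mat f M N = mat (dim_row M) (dim_col M) (\<lambda>ij. f (M $$ ij) (N $$ ij))"

lemma zip_mat_carrier: "M \<in> carrier_mat m n \<Longrightarrow> zip_mat f M N \<in> carrier_mat m n"
  by (simp add: zip_mat_def)

lemma zip_mat_lower_triangular:
  assumes "M \<in> carrier_mat p p" "N \<in> carrier_mat p p" "f 0 0 = 0"
    and "lower_triangular M" "lower_triangular N"
  shows "lower_triangular (zip_mat f M N)"
  using assms by (auto simp: lower_triangular_def zip_mat_def)

lemma zip_mat_upper_triangular:
  assumes "M \<in> carrier_mat p p" "N \<in> carrier_mat p p" "f 0 0 = 0"
    and "upper_triangular M" "upper_triangular N"
  shows "upper_triangular (zip_mat f M N)"
  using assms by (auto simp: upper_triangular_def zip_mat_def)

lemma sum_additive2: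
  fixes f :: "'a::comm_monoid_add \<Rightarrow> 'b::comm_monoid_add \<Rightarrow> 'c::comm_monoid_add"
  assumes "f 0 0 = 0" "\<And>a b c d. f (a + c) (b + d) = f a b + f c d"
  shows "(\<Sum>k\<in>K. f (g k) (h k)) = f (\<Sum>k\<in>K. g k) (\<Sum>k\<in>K. h k)"
  \<comment> \<open>For empty and for infinite \<open>K\<close> all sums are 0, and the claim is
    \<open>f 0 0 = 0\<close>.\<close>
  by (induction K rule: infinite_finite_induct) (simp_all add: assms)

text \<open>A curried ring homomorphism from a product of two rings to the tessarines, with the
  parametrised product on the target side.\<close>

locale pair_hom =
  fixes \<alpha> \<beta> :: real and f :: "'a::semiring_0 \<Rightarrow> 'b::semiring_0 \<Rightarrow> tess"
  assumes zero: "f 0 0 = 0"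
    and add: "f (a + c) (b + d) = f a b + f c d"
    and mult: "tess_mult \<alpha> \<beta> (f a b) (f c d) = f (a * c) (b * d)"
begin

lemma tess_mat_mult_zip:
  assumes "M \<in> carrier_mat p p" "M' \<in> carrier_mat p p" "N \<in> carrier_mat p p" "N' \<in> carrier_mat p p"
  shows "tess_mat_mult \<alpha> \<beta> (zip_mat f M M') (zip_mat f N N') = zip_mat f (M * N) (M' * N')"
  using assms
  by (intro eq_matI)
     (simp_all add: tess_mat_mult_def zip_mat_def mult scalar_prod_def
        sum_additive2[of f, OF zero add] lessThan_atLeast0)

end

text \<open>Both equations are pushed through \<open>f\<close> entrywise. Where the permutations
  differ, the image of \<open>P\<close>, \<open>P'\<close> has entries \<open>f 1 0\<close> or
  \<open>f 0 1\<close>, so the target notion is \<open>is_tess_LUPP\<close>.\<close>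

lemma is_tess_LUPP_zip:
  fixes f :: "'a::field \<Rightarrow> 'b::field \<Rightarrow> tess"
  assumes "pair_hom \<alpha> \<beta> f" and M: "is_LUPP p Z P L U" and M': "is_LUPP p Z' P' L' U'"
  shows "is_tess_LUPP p \<alpha> \<beta> (zip_mat f Z Z') (zip_mat f P P') (zip_mat f L L') (zip_mat f U U')"
proof -
  interpret pair_hom \<alpha> \<beta> f by fact
  have "tess_mat_mult \<alpha> \<beta> (zip_mat f P P') (zip_mat f Z Z') = zip_mat f (P * Z) (P' * Z')"
    using M M' unfolding is_LUPP_def by (intro tess_mat_mult_zip) auto
  also have "\<dots> = zip_mat f (L * U) (L' * U')"
    using M M' by (simp add: is_LUPP_def)
  also have "\<dots> = tess_mat_mult \<alpha> \<beta> (zip_mat f L L') (zip_mat f U U')"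
    using M M' unfolding is_LUPP_def by (intro tess_mat_mult_zip[symmetric]) auto
  finally show ?thesis
    using M M' zip_mat_lower_triangular[of L p L' f] zip_mat_upper_triangular[of U p U' f]
    by (simp add: is_tess_LUPP_def is_LUPP_def zip_mat_carrier zero)
qed

text \<open>Inverse of a + b i \<mapsto> a + sqrt |\<alpha>| b \<epsilon>, for \<alpha> < 0.\<close>

definition of_complex_tess :: "real \<Rightarrow> complex \<Rightarrow> tess" where
  "of_complex_tess \<alpha> z = Tess (Re z) (Im z / sqrt \<bar>\<alpha>\<bar>) 0 0"

text \<open>Inverse of a + b i \<mapsto> (a + sqrt \<alpha> b, a - sqrt \<alpha> b), for \<alpha> >
  0; equivalently x e + y e' with the orthogonal idempotents (1 + i / sqrt \<alpha>) / 2 and (1 - i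
  / sqrt \<alpha>) / 2.\<close>

definition of_reals_tess :: "real \<Rightarrow> real \<Rightarrow> real \<Rightarrow> tess" where
  "of_reals_tess \<alpha> x y = Tess ((x + y) / 2) ((x - y) / (2 * sqrt \<alpha>)) 0 0"

text \<open>The dummy second argument brings the single complex matrix under
  \<open>pair_hom\<close>; the matrix is later paired with itself.\<close>

lemma pair_hom_of_complex:
  assumes "\<alpha> < 0"
  shows "pair_hom \<alpha> \<beta> (\<lambda>z _ :: complex. of_complex_tess \<alpha> z)"
proof -
  define s where "s = sqrt \<bar>\<alpha>\<bar>"
  have s: "s \<noteq> 0" "\<alpha> = - (s * s)" using assms by (auto simp: s_def)
  show ?thesis
    unfolding of_complex_tess_def s_def[symmetric] using s(1)
    by unfold_locales
      (auto simp: s(2) zero_tess_def plus_tess_def tess_mult_def field_simps)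
qed

lemma pair_hom_of_reals:
  assumes "\<alpha> > 0"
  shows "pair_hom \<alpha> \<beta> (of_reals_tess \<alpha>)"
proof -
  define s where "s = sqrt \<alpha>"
  have s: "s \<noteq> 0" "\<alpha> = s * s" using assms by (auto simp: s_def)
  show ?thesis
    unfolding pair_hom_def of_reals_tess_def s_def[symmetric] using s(1)
    by (auto simp: s(2) zero_tess_def plus_tess_def tess_mult_def field_simps)
qed

lemma alpha_complex_iff: "x \<in> alpha_complex \<longleftrightarrow> (\<exists>a b. x = Tess a b 0 0)"
  by (auto simp: alpha_complex_def tess_unit_defs plus_tess_def scaleR_tess_def)

lemma from_complex_mat_eq_zip:
  "from_complex_mat \<alpha> M = zip_mat (\<lambda>z _ :: complex. of_complex_tess \<alpha> z) M M"
  by (intro eq_matI)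
     (auto simp: from_complex_mat_def cmat_def zip_mat_def of_complex_tess_def
        tess_unit_defs plus_tess_def scaleR_tess_def)

lemma from_real_mats_eq_zip:
  assumes "M \<in> carrier_mat p p" "N \<in> carrier_mat p p"
  shows "from_real_mats \<alpha> M N = zip_mat (of_reals_tess \<alpha>) M N"
  using assms
  by (intro eq_matI)
     (auto simp: from_real_mats_def cmat_def zip_mat_def of_reals_tess_def
        tess_unit_defs plus_tess_def scaleR_tess_def)

text \<open>\<beta> is arbitrary, since tessarines without j and k coordinates multiply
  independently of it.\<close>

lemma alpha_LUPP_imp_tess_LUPP:
  assumes "is_alpha_LUPP p \<alpha> Z P L U"
  shows "is_tess_LUPP p \<alpha> \<beta> Z P L U"
proof -
  define A where "A = map_mat t_one Z"
  define B where "B = map_mat t_i Z"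
  have Z: "Z \<in> carrier_mat p p" and "elements_mat Z \<subseteq> alpha_complex"
    using assms by (auto simp: is_alpha_LUPP_def Let_def)
  then have "\<exists>a b. Z $$ (i, j) = Tess a b 0 0" if "i < p" "j < p" for i j
    using that elements_matI[of Z p p i j] alpha_complex_iff by blast
  \<comment> \<open>The j and k coordinates vanish, so \<open>A\<close> and \<open>B\<close>
    determine \<open>Z\<close>.\<close>
  then have Zij: "Tess (t_one (Z $$ (i, j))) (t_i (Z $$ (i, j))) 0 0 = Z $$ (i, j)"
    if "i < p" "j < p" for i j
    using that by (metis tess.sel(1,2))
  consider (neg) P' L' U' where "\<alpha> < 0"
      "is_LUPP p (map_mat complex_of_real A +
         (complex_of_real (sqrt \<bar>\<alpha>\<bar>) * \<i>) \<cdot>\<^sub>m map_mat complex_of_real B) P' L' U'"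
      "P = from_complex_mat \<alpha> P'" "L = from_complex_mat \<alpha> L'" "U = from_complex_mat \<alpha> U'"
    | (pos) P\<^sub>1 L\<^sub>1 U\<^sub>1 P\<^sub>2 L\<^sub>2 U\<^sub>2 where "\<alpha> > 0"
      "is_LUPP p (A + sqrt \<alpha> \<cdot>\<^sub>m B) P\<^sub>1 L\<^sub>1 U\<^sub>1" "is_LUPP p (A - sqrt \<alpha> \<cdot>\<^sub>m B) P\<^sub>2 L\<^sub>2 U\<^sub>2"
      "P = from_real_mats \<alpha> P\<^sub>1 P\<^sub>2" "L = from_real_mats \<alpha> L\<^sub>1 L\<^sub>2" "U = from_real_mats \<alpha> U\<^sub>1 U\<^sub>2"
    using assms unfolding is_alpha_LUPP_def Let_def A_def B_def by blast
  then show ?thesis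
  proof cases
    case neg
    let ?f = "\<lambda>z _ :: complex. of_complex_tess \<alpha> z"
    let ?W = "map_mat complex_of_real A +
      (complex_of_real (sqrt \<bar>\<alpha>\<bar>) * \<i>) \<cdot>\<^sub>m map_mat complex_of_real B"
    \<comment> \<open>The factor sqrt |\<alpha>| on the imaginary part cancels against the division
      in \<open>of_complex_tess\<close>.\<close>
    have "Z = zip_mat ?f ?W ?W"
      using Z neg(1)
      by (intro eq_matI)
         (auto simp: zip_mat_def A_def B_def of_complex_tess_def Zij)
    then show ?thesis
      using is_tess_LUPP_zip[OF pair_hom_of_complex[OF neg(1)] neg(2) neg(2)] neg(3-5)
      by (simp add: from_complex_mat_eq_zip)
  next
    case pos
    \<comment> \<open>Sum and difference of the two real matrices are 2 A and 2 sqrt \<alpha>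
      B.\<close>
    have "Z = zip_mat (of_reals_tess \<alpha>) (A + sqrt \<alpha> \<cdot>\<^sub>m B) (A - sqrt \<alpha> \<cdot>\<^sub>m B)"
      using Z pos(1)
      by (intro eq_matI)
         (auto simp: zip_mat_def A_def B_def of_reals_tess_def Zij)
    moreover have "P = zip_mat (of_reals_tess \<alpha>) P\<^sub>1 P\<^sub>2" "L = zip_mat (of_reals_tess \<alpha>) L\<^sub>1 L\<^sub>2"
      "U = zip_mat (of_reals_tess \<alpha>) U\<^sub>1 U\<^sub>2"
      using pos by (auto simp: is_LUPP_def intro!: from_real_mats_eq_zip)
    ultimately show ?thesis
      using is_tess_LUPP_zip[OF pair_hom_of_reals[OF pos(1)] pos(2,3)] by simp
  qed
qed

definition w_combine :: "real \<Rightarrow> real \<Rightarrow> tess \<Rightarrow> tess \<Rightarrow> tess" where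
  "w_combine \<alpha> \<beta> x y = tess_mult \<alpha> \<beta> x (w1 \<beta>) + tess_mult \<alpha> \<beta> y (w2 \<beta>)"

lemma w_combine_zero: "w_combine \<alpha> \<beta> 0 0 = 0"
  by (simp add: w_combine_def tess_mult_def zero_tess_def plus_tess_def)

lemma w_combine_add:
  "w_combine \<alpha> \<beta> (a + c) (b + d) = w_combine \<alpha> \<beta> a b + w_combine \<alpha> \<beta> c d"
  by (simp add: w_combine_def tess_mult_add_left)

text \<open>With s = sqrt \<beta>: the square of s + j is 2 s (s + j), likewise for s - j, and (s +
  j) (s - j) = s^2 - \<beta> = 0.\<close>

lemma w_orthogonal_idempotents:
  assumes "\<beta> > 0"
  shows "tess_mult \<alpha> \<beta> (w1 \<beta>) (w1 \<beta>) = w1 \<beta>" "tess_mult \<alpha> \<beta> (w2 \<beta>) (w2 \<beta>) = w2 \<beta>"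
    "tess_mult \<alpha> \<beta> (w1 \<beta>) (w2 \<beta>) = 0"
proof -
  define s where "s = sqrt \<beta>"
  have s: "s \<noteq> 0" "\<beta> = s * s" using assms by (auto simp: s_def)
  show "tess_mult \<alpha> \<beta> (w1 \<beta>) (w1 \<beta>) = w1 \<beta>" "tess_mult \<alpha> \<beta> (w2 \<beta>) (w2 \<beta>) = w2 \<beta>"
    "tess_mult \<alpha> \<beta> (w1 \<beta>) (w2 \<beta>) = 0"
    unfolding w1_def w2_def s_def[symmetric] using s(1)
    by (auto simp: s(2) tess_unit_defs tess_mult_def plus_tess_def minus_tess_def
        scaleR_tess_def zero_tess_def field_simps)
qed

text \<open>After expansion, \<open>interchange\<close> regroups each of the four terms as a product
  of coefficients times a product of idempotents; the cross terms vanish.\<close>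

lemma w_combine_mult:
  assumes "\<beta> > 0"
  shows "tess_mult \<alpha> \<beta> (w_combine \<alpha> \<beta> a b) (w_combine \<alpha> \<beta> c d) =
    w_combine \<alpha> \<beta> (tess_mult \<alpha> \<beta> a c) (tess_mult \<alpha> \<beta> b d)"
proof -
  let ?m = "tess_mult \<alpha> \<beta>"
  have add_right: "?m x (y + z) = ?m x y + ?m x z" for x y z
    by (metis tess_mult_add_left tess_mult_commute)
  have interchange: "?m (?m x u) (?m y v) = ?m (?m x y) (?m u v)" for x y u v
    by (metis tess_mult_assoc tess_mult_commute)
  have orth: "?m (w2 \<beta>) (w1 \<beta>) = 0"
    using w_orthogonal_idempotents(3)[OF assms] by (simp add: tess_mult_commute)
  have zero: "?m x 0 = 0" for x
    by (simp add: tess_mult_def zero_tess_def)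
  show ?thesis
    by (simp add: w_combine_def tess_mult_add_left add_right interchange zero orth
        w_orthogonal_idempotents[OF assms])
qed

text \<open>Since w1 and w2 are 1/2 + j / (2 sqrt \<beta>) and 1/2 - j / (2 sqrt \<beta>),
  collecting x w1 + y w2 by 1 and j gives the formula of the theorem.\<close>

lemma combine_sd_eq_zip:
  assumes "\<beta> > 0" "M \<in> carrier_mat p p" "N \<in> carrier_mat p p"
  shows "combine_sd \<alpha> \<beta> M N = zip_mat (w_combine \<alpha> \<beta>) M N"
proof -
  have "(1 / 2) *\<^sub>R (x + y) + tess_mult \<alpha> \<beta> ((1 / (2 * sqrt \<beta>)) *\<^sub>R (x - y)) unit_j
      = w_combine \<alpha> \<beta> x y" for x y
    unfolding w_combine_def w1_def w2_def using assms(1)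
    by (intro tess.expand) (auto simp: tess_mult_def tess_unit_defs field_simps)
  then show ?thesis
    using assms
    by (intro eq_matI) (auto simp: combine_sd_def tess_mat_smult_def zip_mat_def)
qed

text \<open>Counterpart of \<open>tess_mat_mult_zip\<close>. As \<open>tess\<close> has no class
  product, \<open>w_combine\<close> cannot instantiate \<open>pair_hom\<close>, and
  \<open>tess_mat_mult\<close> stands on both sides.\<close>

lemma tess_mat_mult_w_combine:
  assumes "\<beta> > 0" "M \<in> carrier_mat p p" "M' \<in> carrier_mat p p"
    and "N \<in> carrier_mat p p" "N' \<in> carrier_mat p p"
  shows "tess_mat_mult \<alpha> \<beta> (zip_mat (w_combine \<alpha> \<beta>) M M') (zip_mat (w_combine \<alpha> \<beta>) N N') =
    zip_mat (w_combine \<alpha> \<beta>) (tess_mat_mult \<alpha> \<beta> M N) (tess_mat_mult \<alpha> \<beta> M' N')"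
  using assms
  by (intro eq_matI)
     (simp_all add: tess_mat_mult_def zip_mat_def w_combine_mult
        sum_additive2[of "w_combine \<alpha> \<beta>", OF w_combine_zero w_combine_add])

theorem proposition6:
  fixes \<alpha> \<beta> :: real and p :: nat
    and X X\<^sub>s X\<^sub>d P\<^sub>s L\<^sub>s U\<^sub>s P\<^sub>d L\<^sub>d U\<^sub>d :: "tess mat"
  assumes "\<alpha> \<noteq> 0" and "\<beta> > 0"
    and "X \<in> carrier_mat p p"
    and "X\<^sub>s \<in> carrier_mat p p" and "elements_mat X\<^sub>s \<subseteq> alpha_complex"
    and "X\<^sub>d \<in> carrier_mat p p" and "elements_mat X\<^sub>d \<subseteq> alpha_complex"
    and "X = tess_mat_smult \<alpha> \<beta> X\<^sub>s (w1 \<beta>) + tess_mat_smult \<alpha> \<beta> X\<^sub>d (w2 \<beta>)"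
    and "is_alpha_LUPP p \<alpha> X\<^sub>s P\<^sub>s L\<^sub>s U\<^sub>s"
    and "is_alpha_LUPP p \<alpha> X\<^sub>d P\<^sub>d L\<^sub>d U\<^sub>d"
  shows "is_tess_LUPP p \<alpha> \<beta> X
           (combine_sd \<alpha> \<beta> P\<^sub>s P\<^sub>d) (combine_sd \<alpha> \<beta> L\<^sub>s L\<^sub>d) (combine_sd \<alpha> \<beta> U\<^sub>s U\<^sub>d)"
proof -
  let ?f = "w_combine \<alpha> \<beta>"
  \<comment> \<open>Both factorizations now live in the same algebra, with the \<beta> of the
    theorem.\<close>
  note s = alpha_LUPP_imp_tess_LUPP[OF assms(9), of \<beta>, unfolded is_tess_LUPP_def]
  note d = alpha_LUPP_imp_tess_LUPP[OF assms(10), of \<beta>, unfolded is_tess_LUPP_def]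
  have X: "X = zip_mat ?f X\<^sub>s X\<^sub>d"
    unfolding assms(8) using assms(4,6)
    by (intro eq_matI) (auto simp: zip_mat_def w_combine_def tess_mat_smult_def)
  have comb: "combine_sd \<alpha> \<beta> P\<^sub>s P\<^sub>d = zip_mat ?f P\<^sub>s P\<^sub>d"
    "combine_sd \<alpha> \<beta> L\<^sub>s L\<^sub>d = zip_mat ?f L\<^sub>s L\<^sub>d" "combine_sd \<alpha> \<beta> U\<^sub>s U\<^sub>d = zip_mat ?f U\<^sub>s U\<^sub>d"
    using s d by (auto intro!: combine_sd_eq_zip[OF assms(2)])
  \<comment> \<open>Both sides split into s and d components, where the equations from
    \<open>s\<close> and \<open>d\<close> apply.\<close>
  have "tess_mat_mult \<alpha> \<beta> (zip_mat ?f P\<^sub>s P\<^sub>d) (zip_mat ?f X\<^sub>s X\<^sub>d) =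
      tess_mat_mult \<alpha> \<beta> (zip_mat ?f L\<^sub>s L\<^sub>d) (zip_mat ?f U\<^sub>s U\<^sub>d)"
    using s d by (simp add: tess_mat_mult_w_combine[OF assms(2), where p = p])
  moreover have "lower_triangular (zip_mat ?f L\<^sub>s L\<^sub>d)" "upper_triangular (zip_mat ?f U\<^sub>s U\<^sub>d)"
    using s d zip_mat_lower_triangular[of L\<^sub>s p L\<^sub>d ?f] zip_mat_upper_triangular[of U\<^sub>s p U\<^sub>d ?f]
    by (simp_all add: w_combine_zero)
  ultimately show ?thesis
    unfolding comb is_tess_LUPP_def X using s d by (simp add: zip_mat_carrier)
qed

end
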